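(* Let $A$ be a commutative associative ring with identity and let $(\cdot,\cdot)\colon A((t))\times A((t))\to A$ be an $A$-bilinear pairing that is continuous in each argument (i.e. for each fixed value of either argument, the resulting map $A((t))\to A$ in the other argument is continuous, where $A$ carries the discrete topology). Suppose that for all $f,g\in A((t))$ and all integers $l\geq 2$ we have $$(f,g)=(\varphi_l(f),\varphi_l(g)).$$ Then there exists an element $e\in A$ such that $(f,g)=e\,\mathrm{Res}(f,g)$ for all $f,g\in A((t))$.
   Context: $A((t))=A[[t]][t^{-1}]$ is the ring of Laurent series over $A$, equipped with the topology in which the $A$-submodules $t^mA[[t]]$, $m\in\mathbb{Z}$, form a neighbourhood basis at zero. For an integer $l\geq 2$, $\varphi_l$ denotes the continuous $A$-algebra automorphism of $A((t))$ sending $t$ to $t+t^l$, i.e. $\varphi_l\left(\sum_k a_kt^k\right)=\sum_k a_k(t+t^l)^k$, where for negative $k$ the power is taken in $A((t))$ (note $t+t^l=t(1+t^{l-1})$ is invertible). Let $\Omega^{1}_{A((t))/A}$ be the module of Kähler differentials of $A((t))$ over $A$, and let $\Omega^{\mathrm{cont},1}_{A((t))/A}=\Omega^1_{A((t))/A}/Q$, where $Q$ is the $A((t))$-submodule generated by the elements $df-\frac{\partial f}{\partial t}dt$, $f\in A((t))$. Every element $\omega\in\Omega^{\mathrm{cont},1}_{A((t))/A}$ can be written uniquely as $\left(\sum_i a_it^i\right)dt$ with $\sum_i a_it^i\in A((t))$, and $\mathrm{Res}(\omega)=a_{-1}$. For $f,g\in A((t))$, $\mathrm{Res}(f,g)=\mathrm{Res}(f\,dg)$;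 concretely, $\mathrm{Res}(f,g)$ is the coefficient of $t^{-1}$ in $f\cdot\frac{\partial g}{\partial t}$. *)

theory Defs
  imports
    "HOL-Analysis.Abstract_Topology"
    "HOL-Analysis.Infinite_Sum"
    "HOL-Computational_Algebra.Formal_Laurent_Series"
begin

unbundle fps_syntax

text \<open>
  The library topology on Laurent series is given by a metric. It is the one in which the
  sets \<open>f + t\<^sup>m A[[t]]\<close> form a neighbourhood basis at \<open>f\<close>.
\<close>

lemma fls_dist_less_iff:
  fixes f g :: "'a::group_add fls"
  shows "dist f g < inverse (2 ^ m) \<longleftrightarrow> (\<forall>k\<le>int m. f $$ k = g $$ k)"
proof (cases "f = g")
  case True
  then show ?thesis by simp
next
  case False
  hence nz: "f - g \<noteq> 0" by simp
  let ?s = "fls_subdegree (f - g)"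
  have R: "(\<forall>k\<le>int m. f $$ k = g $$ k) \<longleftrightarrow> int m < ?s"
  proof
    assume *: "\<forall>k\<le>int m. f $$ k = g $$ k"
    have "f $$ ?s \<noteq> g $$ ?s"
      using nth_fls_subdegree_nonzero[OF nz] by simp
    with * show "int m < ?s" by (meson not_le)
  next
    assume *: "int m < ?s"
    show "\<forall>k\<le>int m. f $$ k = g $$ k"
    proof (intro allI impI)
      fix k assume "k \<le> int m"
      with * have "(f - g) $$ k = 0" by (intro fls_eq0_below_subdegree) simp
      thus "f $$ k = g $$ k" by simp
    qed
  qed
  have L: "dist f g < inverse (2 ^ m) \<longleftrightarrow> int m < ?s"
  proof (cases "?s \<ge> 0")
    case True
    have "dist f g < inverse (2 ^ m) \<longleftrightarrow> (2::real) ^ m < 2 ^ nat ?s"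
      using True False by (simp add: dist_fls_def)
    also have "\<dots> \<longleftrightarrow> int m < ?s"
      using True by (simp add: nat_less_iff zless_nat_conj) linarith
    finally show ?thesis .
  next
    case neg: False
    have "inverse (2 ^ m) \<le> (1::real)"
      by (simp add: inverse_le_1_iff)
    moreover have "(1::real) \<le> 2 ^ nat (- ?s)" by simp
    ultimately have "inverse (2 ^ m) \<le> (2::real) ^ nat (- ?s)" by linarith
    thus ?thesis using neg False by (simp add: dist_fls_def)
  qed
  show ?thesis using L R by simp
qed

lemma open_fls_iff:
  fixes U :: "'a::group_add fls set"
  shows "open U \<longleftrightarrow> (\<forall>f\<in>U. \<exists>m::int. {g. \<forall>k<m. g $$ k = f $$ k} \<subseteq> U)"
proof
  assume "open U"
  show "\<forall>f\<in>U. \<exists>m::int. {g. \<forall>k<m. g $$ k = f $$ k} \<subseteq> U"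
  proof
    fix f assume "f \<in> U"
    with \<open>open U\<close> obtain r where r: "r > 0" "{g. dist g f < r} \<subseteq> U"
      unfolding open_fls_def by blast
    obtain n where n: "inverse (2 ^ n) < r"
      using real_arch_pow_inv[of r "1/2"] r(1) by (auto simp: power_one_over inverse_eq_divide)
    have "{g. \<forall>k<int n + 1. g $$ k = f $$ k} \<subseteq> {g. dist g f < inverse (2 ^ n)}"
      by (auto simp: fls_dist_less_iff)
    also have "\<dots> \<subseteq> {g. dist g f < r}" using n by auto
    finally show "\<exists>m::int. {g. \<forall>k<m. g $$ k = f $$ k} \<subseteq> U" using r(2) by blast
  qed
next
  assume *: "\<forall>f\<in>U. \<exists>m::int. {g. \<forall>k<m. g $$ k = f $$ k} \<subseteq> U"
  show "open U"
    unfolding open_fls_def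
  proof
    fix f assume "f \<in> U"
    with * obtain m :: int where m: "{g. \<forall>k<m. g $$ k = f $$ k} \<subseteq> U" by blast
    have "{g. dist g f < inverse (2 ^ nat m)} \<subseteq> U"
      using m by (auto simp: fls_dist_less_iff)
    moreover have "inverse (2 ^ nat m) > (0::real)" by simp
    ultimately show "\<exists>r>0. {g. dist g f < r} \<subseteq> U" by blast
  qed
qed

text \<open>
  The library's integer powers and composition of Laurent series require coefficients in a
  division ring or a field, so the powers \<open>(t + t\<^sup>l)\<^sup>k\<close> with \<open>k :: int\<close> are defined here,
  using that \<open>t + t\<^sup>l\<close> has leading coefficient \<open>1\<close> for \<open>l \<ge> 2\<close>.
\<close>

definition fls_subst_pow :: "nat \<Rightarrow> int \<Rightarrow> 'a::comm_ring_1 fls" where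
  "fls_subst_pow l k =
     (if k \<ge> 0 then (fls_X + fls_X ^ l) ^ nat k
      else fls_right_inverse (fls_X + fls_X ^ l) 1 ^ nat (- k))"

definition fls_phi :: "nat \<Rightarrow> 'a::comm_ring_1 fls \<Rightarrow> 'a fls" where
  "fls_phi l f = (\<Sum>\<^sub>\<infinity>k::int. fls_const (f $$ k) * fls_subst_pow l k)"

lemma fls_subst_subdegree:
  assumes "l \<ge> 2"
  shows "fls_subdegree (fls_X + fls_X ^ l :: 'a::comm_ring_1 fls) = 1"
  using assms by (intro fls_subdegree_eqI) (auto simp: fls_X_power_nth)

lemma fls_subst_inverse:
  assumes "l \<ge> 2"
  shows "(fls_X + fls_X ^ l) * fls_right_inverse (fls_X + fls_X ^ l) 1 = (1 :: 'a::comm_ring_1 fls)"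
  using assms by (intro fls_right_inverse) (auto simp: fls_subst_subdegree fls_X_power_nth)

lemma fls_power_nth_below:
  fixes u :: "'a::comm_ring_1 fls"
  assumes "\<And>n. n < d \<Longrightarrow> u $$ n = 0" "n < int k * d"
  shows "u ^ k $$ n = 0"
proof (cases "u ^ k = 0")
  case False
  have "int k * d \<le> int k * fls_subdegree u"
  proof (cases "k = 0")
    case False
    with \<open>u ^ k \<noteq> 0\<close> have "u \<noteq> 0" by (auto simp: power_0_left)
    thus ?thesis using assms(1) by (auto intro!: mult_left_mono fls_subdegree_geI)
  qed simp
  with assms(2) fls_pow_subdegree_ge[OF False] show ?thesis
    by (intro fls_eq0_below_subdegree) linarith
qed simp

lemma fls_subst_pow_nth_below:
  assumes "l \<ge> 2" "n < k"
  shows "(fls_subst_pow l k :: 'a::comm_ring_1 fls) $$ n = 0"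
proof (cases "k \<ge> 0")
  case True
  then show ?thesis
    using assms fls_power_nth_below[of 1 "fls_X + fls_X ^ l :: 'a fls" n "nat k"]
    by (auto simp: fls_subst_pow_def fls_X_power_nth)
next
  case False
  then show ?thesis
    using assms fls_power_nth_below[of "-1" "fls_right_inverse (fls_X + fls_X ^ l) 1 :: 'a fls" n "nat (- k)"]
    by (auto simp: fls_subst_pow_def fls_subst_subdegree)
qed

lemma fls_phi_has_sum_nth:
  fixes f :: "'a::comm_ring_1 fls"
  assumes l: "l \<ge> 2"
  shows "((\<lambda>k::int. fls_const (f $$ k) * fls_subst_pow l k) has_sum fls_phi l f) UNIV"
    and "fls_phi l f $$ n = (\<Sum>k=fls_subdegree f..n. f $$ k * fls_subst_pow l k $$ n)"
proof -
  let ?s = "fls_subdegree f"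
  let ?c = "\<lambda>n. \<Sum>k=?s..n. f $$ k * fls_subst_pow l k $$ n"
  let ?t = "\<lambda>k::int. fls_const (f $$ k) * fls_subst_pow l k"
  define g where "g = Abs_fls ?c"
  have g: "g $$ n = ?c n" for n
    unfolding g_def by (rule nth_Abs_fls_lower_bound[of ?s]) auto
  have S: "sum ?t F $$ n = g $$ n" if "finite F" "{?s..N} \<subseteq> F" "n \<le> N" for F N n
  proof -
    have "sum ?t F $$ n = (\<Sum>k\<in>F. f $$ k * fls_subst_pow l k $$ n)"
      by (induction F rule: infinite_finite_induct) auto
    also have "\<dots> = ?c n"
      using that l by (intro sum.mono_neutral_right) (auto simp: fls_subst_pow_nth_below not_le)
    finally show ?thesis by (simp add: g)
  qed
  have hs: "(?t has_sum g) UNIV"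
    unfolding has_sum_def tendsto_def
  proof (intro allI impI)
    fix U assume "open U" "g \<in> U"
    then obtain m :: int where m: "{h. \<forall>k<m. h $$ k = g $$ k} \<subseteq> U"
      unfolding open_fls_iff by blast
    show "eventually (\<lambda>F. sum ?t F \<in> U) (finite_subsets_at_top UNIV)"
      unfolding eventually_finite_subsets_at_top
      using S[of _ m] m by (intro exI[of _ "{?s..m}"]) auto
  qed
  hence eq: "fls_phi l f = g"
    unfolding fls_phi_def by (rule infsumI)
  from hs eq show "(?t has_sum fls_phi l f) UNIV" by simp
  from g eq show "fls_phi l f $$ n = ?c n" by simp
qed

definition fls_bilinear :: "('a::comm_ring_1 fls \<Rightarrow> 'a fls \<Rightarrow> 'a) \<Rightarrow> bool" where
  "fls_bilinear B \<longleftrightarrow>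
     (\<forall>f. module_hom (\<lambda>a h. fls_const a * h) (*) (\<lambda>g. B f g)) \<and>
     (\<forall>g. module_hom (\<lambda>a h. fls_const a * h) (*) (\<lambda>f. B f g))"

definition fls_separately_continuous :: "('a::comm_ring_1 fls \<Rightarrow> 'a fls \<Rightarrow> 'a) \<Rightarrow> bool" where
  "fls_separately_continuous B \<longleftrightarrow>
     (\<forall>f. continuous_map euclidean (discrete_topology UNIV) (\<lambda>g. B f g)) \<and>
     (\<forall>g. continuous_map euclidean (discrete_topology UNIV) (\<lambda>f. B f g))"

text \<open>
  In the continuous differentials \<open>f dg = f (dg/dt) dt\<close>, whose residue is the coefficient
  of \<open>t\<^sup>-\<^sup>1\<close> of \<open>f (dg/dt)\<close>.
\<close>

definition fls_Res :: "'a::comm_ring_1 fls \<Rightarrow> 'a fls \<Rightarrow> 'a" where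
  "fls_Res f g = fls_residue (f * fls_deriv g)"

end

theory Submission
  imports Defs
begin

text \<open>
  Let \<open>gram i j = (t\<^sup>i, t\<^sup>j)\<close>. A gliding-hump argument shows that separate continuity makes \<open>gram\<close>
  finitely supported on every quadrant, so that the invariance under \<open>t \<mapsto> t + t\<^bsup>n+1\<^esup>\<close> becomes a
  finite identity between the \<open>gram i j\<close>. Its lowest-order part
  \<open>i gram (i + n) j + j gram i (j + n) = 0\<close> holds up to terms of degree at least \<open>i + j + 2n\<close>. Descending
  in the degree on quadrants gives a global \<open>D\<close> with \<open>gram i j = 0\<close> for \<open>i + j > D\<close>; then large \<open>n\<close>
  gives \<open>gram i (d - i) = i h d\<close> for every \<open>d\<close>.

  Over a ring with torsion this does not yet force \<open>h d = 0\<close> for \<open>d \<noteq> 0\<close>, since in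
  characteristic \<open>p\<close> the infinitesimal identities also hold for \<open>Res (t\<^bsup>-p\<^esup> f dg)\<close>. The higher-order
  terms for large \<open>n\<close> show, by induction on \<open>r\<close>, that the binomial coefficient of \<open>d\<close> over \<open>r\<close>
  annihilates \<open>h d\<close> for all \<open>r > 0\<close>. For \<open>d > 0\<close> take \<open>r = d\<close>; for \<open>d < 0\<close> Vandermonde's identity
  transfers the annihilation to the binomial coefficients of \<open>-d\<close>.
\<close>

subsection \<open>Integer binomial coefficients\<close>

text \<open>
  The constant \<^const>\<open>gbinomial\<close> carries a sort constraint which excludes the type
  \<^typ>\<open>int\<close> from input.
\<close>

definition ibinomial :: "int \<Rightarrow> nat \<Rightarrow> int" where
  "ibinomial a k = (\<Prod>i=0..<k. a - int i) div fact k"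

lemma of_int_ibinomial: "of_int (ibinomial a k) = (of_int a gchoose k :: rat)"
  unfolding ibinomial_def gbinomial_prod_rev[symmetric] by (rule of_int_gbinomial)

lemma ibinomial_0_right [simp]: "ibinomial a 0 = 1"
  by (simp add: ibinomial_def)

lemma ibinomial_1_right [simp]: "ibinomial a (Suc 0) = a"
  by (simp add: ibinomial_def)

lemma ibinomial_0_left: "ibinomial 0 k = (if k = 0 then 1 else 0)"
  using of_int_ibinomial[of 0 k] by (simp add: gbinomial_0_left split: if_splits)

lemma ibinomial_self [simp]: "ibinomial (int k) k = 1"
  using of_int_ibinomial[of "int k" k] binomial_gbinomial[of k k, where 'a=rat] by simp

lemma ibinomial_Suc_Suc: "ibinomial (a + 1) (Suc k) = ibinomial a k + ibinomial a (Suc k)"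
proof -
  have "of_int (ibinomial (a + 1) (Suc k)) = (of_int (ibinomial a k + ibinomial a (Suc k)) :: rat)"
    by (simp add: of_int_ibinomial gbinomial_Suc_Suc)
  then show ?thesis by (simp only: of_int_eq_iff)
qed

lemma ibinomial_Vandermonde:
  "ibinomial (a + b) k = (\<Sum>j\<le>k. ibinomial a j * ibinomial b (k - j))"
proof -
  have "of_int (ibinomial (a + b) k) = (of_int (\<Sum>j\<le>k. ibinomial a j * ibinomial b (k - j)) :: rat)"
    using gbinomial_Vandermonde[of "of_int a :: rat" "of_int b" k, symmetric]
    by (simp add: of_int_ibinomial atLeast0AtMost)
  then show ?thesis by (simp only: of_int_eq_iff)
qed

text \<open>By absorption, \<open>(r + 1) ibinomial a (r + 1) = (a - r) ibinomial a r\<close>, and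
  here \<open>a - r = - (x + 1) (r + 1)\<close>; the factor \<open>r + 1\<close> cancels over the
  integers.\<close>

lemma ibinomial_cancel:
  assumes "a = - x * int (Suc r) - 1"
  shows "ibinomial a (Suc r) + (x + 1) * ibinomial a r = 0"
proof -
  have "int (Suc r) * ibinomial a (Suc r) = (a - int r) * ibinomial a r"
  proof -
    have "of_int (int (Suc r) * ibinomial a (Suc r)) = (of_int ((a - int r) * ibinomial a r) :: rat)"
      using gbinomial_mult_1[of "of_int a :: rat" r]
      by (simp add: of_int_ibinomial algebra_simps)
    then show ?thesis by (simp only: of_int_eq_iff)
  qed
  also have "a - int r = - (x + 1) * int (Suc r)"
    using assms by (simp add: algebra_simps)
  finally have "int (Suc r) * (ibinomial a (Suc r) + (x + 1) * ibinomial a r) = 0"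
    by (simp add: algebra_simps)
  then show ?thesis by (simp del: of_nat_Suc)
qed

text \<open>Vandermonde for \<open>m + a\<close>, where \<open>ibinomial_cancel\<close> removes the
  summand \<open>k = 0\<close>. Modulo the lower \<open>ibinomial m k\<close> with
  \<open>k > 0\<close>, only \<open>ibinomial m (Suc r)\<close> is left, which is the form needed
  for an induction on \<open>r\<close>.\<close>

lemma ibinomial_substitution_coeff:
  assumes a: "a = - x * int (Suc r) - 1"
  shows "ibinomial (m + a) (Suc r) + (x + 1) * ibinomial (m + a) r
       = (\<Sum>k=1..r. ibinomial m k * (ibinomial a (Suc r - k) + (x + 1) * ibinomial a (r - k)))
         + ibinomial m (Suc r)"
proof -
  let ?g = "\<lambda>k. ibinomial m k * (ibinomial a (Suc r - k) + (x + 1) * ibinomial a (r - k))"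
  have "ibinomial (m + a) (Suc r) + (x + 1) * ibinomial (m + a) r
      = (\<Sum>k\<le>r. ?g k) + ibinomial m (Suc r)"
    unfolding ibinomial_Vandermonde[of m a]
    by (simp add: sum_distrib_left distrib_left sum.distrib mult_ac)
  also have "(\<Sum>k\<le>r. ?g k) = ?g 0 + (\<Sum>k=1..r. ?g k)"
    by (simp add: atMost_atLeast0 sum.atLeast_Suc_atMost)
  also have "?g 0 = 0"
    using ibinomial_cancel[OF a] by simp
  finally show ?thesis by simp
qed

subsection \<open>Powers of the substituted variable\<close>

lemma fls_subst_pow_0 [simp]: "fls_subst_pow l 0 = 1"
  by (simp add: fls_subst_pow_def)

lemma fls_subst_pow_add_1:
  assumes "l \<ge> 2"
  shows "fls_subst_pow l (k + 1) = fls_subst_pow l k * (fls_X + fls_X ^ l :: 'a::comm_ring_1 fls)"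
proof (cases "k \<ge> 0")
  case True
  then show ?thesis by (simp add: fls_subst_pow_def nat_add_distrib mult.commute)
next
  case False
  let ?u = "fls_X + fls_X ^ l :: 'a fls"
  let ?v = "fls_right_inverse ?u 1"
  have uv: "?v * ?u = 1"
    using fls_subst_inverse[OF assms] by (simp add: mult.commute)
  have "nat (- k) = Suc (nat (- k - 1))" using False by simp
  then have "fls_subst_pow l k * ?u = ?v ^ nat (- k - 1) * (?v * ?u)"
    using False by (simp add: fls_subst_pow_def mult_ac)
  also have "\<dots> = fls_subst_pow l (k + 1)"
    using False uv by (auto simp: fls_subst_pow_def)
  finally show ?thesis ..
qed

text \<open>This is the binomial series of (t + t^(n+1))^k for every integer exponent. The candidate
  series \<open>P k\<close> obeys the same recursion in \<open>k\<close> by Pascal's rule;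
  invertibility of t + t^(n+1) lets the induction also run downwards from
  \<open>k = 0\<close>.\<close>

lemma fls_subst_pow_nth:
  fixes k m :: int
  assumes n: "n \<ge> 1"
  shows "(fls_subst_pow (Suc n) k :: 'a::comm_ring_1 fls) $$ m =
           (if m \<ge> k \<and> int n dvd (m - k) then of_int (ibinomial k (nat ((m - k) div int n))) else 0)"
proof -
  let ?u = "fls_X + fls_X ^ Suc n :: 'a fls"
  define p where "p k m = (if m \<ge> k \<and> int n dvd (m - k)
      then of_int (ibinomial k (nat ((m - k) div int n))) else 0 :: 'a)" for k m :: int
  define P where "P k = Abs_fls (p k)" for k
  have P: "P k $$ m = p k m" for k m
    unfolding P_def by (rule nth_Abs_fls_lower_bound[of k]) (simp add: p_def)
  have p_of: "p k m = of_int (ibinomial k a)" if "m = k + int n * int a" for k m a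
    using that n by (simp add: p_def)
  have pascal: "p (k + 1) m = p k (m - 1) + p k (m - 1 - int n)" for k m
  proof (cases "m \<ge> k + 1 \<and> int n dvd (m - 1 - k)")
    case True
    then obtain q where q: "m - 1 - k = int n * q" by (auto elim: dvdE)
    with True n have "0 \<le> int n * q" by linarith
    with n have "q \<ge> 0" by (simp add: zero_le_mult_iff)
    then obtain a where "q = int a" by (auto elim: nonneg_int_cases)
    with q have a: "m = k + 1 + int n * int a" by simp
    show ?thesis
    proof (cases a)
      case 0
      then show ?thesis using a n by (simp add: p_def)
    next
      case (Suc b)
      have "p (k + 1) m = of_int (ibinomial (k + 1) (Suc b))"
        "p k (m - 1) = of_int (ibinomial k (Suc b))" "p k (m - 1 - int n) = of_int (ibinomial k b)"
        by (rule p_of, use a Suc in \<open>simp add: algebra_simps\<close>)+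
      then show ?thesis by (simp add: ibinomial_Suc_Suc)
    qed
  next
    case False
    have "m - 1 - int n - k = m - 1 - k - int n" by simp
    then have "int n dvd (m - 1 - int n - k) \<longleftrightarrow> int n dvd (m - 1 - k)"
      by (simp only: dvd_diff_left_iff[OF dvd_refl])
    moreover have "m - (k + 1) = m - 1 - k" by simp
    then have "\<not> (m \<ge> k + 1 \<and> int n dvd (m - (k + 1)))"
      using False by (simp only: not_False_eq_True)
    ultimately have "p (k + 1) m = 0" "p k (m - 1) = 0" "p k (m - 1 - int n) = 0"
      using False unfolding p_def by auto
    then show ?thesis by simp
  qed
  have step: "P (k + 1) = P k * ?u" for k
  proof (rule fls_eqI)
    fix m
    have "(P k * ?u) $$ m = P k $$ (m - 1) + P k $$ (m - 1 - int n)"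
      by (simp add: distrib_left fls_X_power_times_conv_shift fls_X_times_conv_shift algebra_simps del: power_Suc)
    then show "P (k + 1) $$ m = (P k * ?u) $$ m" by (simp add: P pascal)
  qed
  have cancel: "f = g" if "f * ?u = g * ?u" for f g :: "'a fls"
  proof -
    have uv: "?u * fls_right_inverse ?u 1 = 1"
      using n by (intro fls_subst_inverse) simp
    have "f * (?u * fls_right_inverse ?u 1) = g * (?u * fls_right_inverse ?u 1)"
      using that by (simp only: mult.assoc[symmetric])
    then show ?thesis by (simp only: uv mult_1_right)
  qed
  have n2: "Suc n \<ge> 2" using n by simp
  have "fls_subst_pow (Suc n) k = P k"
  proof (induction k rule: int_induct[where k=0])
    case base
    show ?case
      using n by (intro fls_eqI) (auto simp: P p_def ibinomial_0_left zero_le_mult_iff elim!: dvdE)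
  next
    case (step1 i)
    then show ?case by (simp only: step fls_subst_pow_add_1[OF n2])
  next
    case (step2 i)
    then show ?case
      using step[of "i - 1"] fls_subst_pow_add_1[OF n2, of "i - 1", where 'a='a]
      by - (rule cancel, simp only: diff_add_cancel)
  qed
  then show ?thesis by (simp add: P p_def)
qed

lemma fls_phi_X_intpow:
  assumes "l \<ge> 2"
  shows "fls_phi l (fls_X_intpow k) = (fls_subst_pow l k :: 'a::comm_ring_1 fls)"
proof (cases "(1::'a) = 0")
  case True
  have "f = g" for f g :: "'a fls"
  proof (rule fls_eqI)
    have "x = 0" for x :: 'a using True by (metis mult_1 mult_zero_left)
    then show "f $$ n = g $$ n" for n by metis
  qed
  then show ?thesis by metis
next
  case False
  have "fls_subdegree (fls_X_intpow k :: 'a fls) = k"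
    using False by (intro fls_subdegree_eqI) auto
  then have "fls_phi l (fls_X_intpow k) $$ n
      = (\<Sum>i=k..n. if i = k then fls_subst_pow l k $$ n else 0 :: 'a)" for n
    unfolding fls_phi_has_sum_nth(2)[OF assms] by (intro sum.cong) auto
  then show ?thesis
    by (intro fls_eqI) (simp add: fls_subst_pow_nth_below[OF assms])
qed

subsection \<open>Continuity\<close>

text \<open>The kernel is the preimage of the open set {0}, so it contains a basic neighbourhood of
  zero.\<close>

lemma continuous_functional_vanishes:
  fixes L :: "'a::comm_ring_1 fls \<Rightarrow> 'a"
  assumes "module_hom (\<lambda>a h. fls_const a * h) (*) L"
    and "continuous_map euclidean (discrete_topology UNIV) L"
  obtains m :: int where "\<And>h. (\<And>k. k < m \<Longrightarrow> h $$ k = 0) \<Longrightarrow> L h = 0"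
proof -
  interpret module_hom "\<lambda>a h. fls_const a * h" "(*)" L by (rule assms)
  have "open {h. L h = 0}"
    using openin_continuous_map_preimage[OF assms(2), of "{0}"] by simp
  then have "\<exists>m::int. {h. \<forall>k<m. h $$ k = (0 :: 'a fls) $$ k} \<subseteq> {h. L h = 0}"
    unfolding open_fls_iff by (rule bspec) (simp add: zero)
  then show ?thesis using that by auto
qed

text \<open>\<open>L\<close> kills the tail of \<open>f\<close> from a suitable order
  \<open>m\<close> on, so only a finite truncation counts. Its index range can then be exchanged for
  any finite \<open>S\<close> carrying all nonzero terms.\<close>

lemma continuous_functional_expand:
  fixes L :: "'a::comm_ring_1 fls \<Rightarrow> 'a"
  assumes hom: "module_hom (\<lambda>a h. fls_const a * h) (*) L"
    and cont: "continuous_map euclidean (discrete_topology UNIV) L"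
    and S: "finite S" "\<And>i. i \<notin> S \<Longrightarrow> f $$ i * L (fls_X_intpow i) = 0"
  shows "L f = (\<Sum>i\<in>S. f $$ i * L (fls_X_intpow i))"
proof -
  interpret module_hom "\<lambda>a h. fls_const a * h" "(*)" L by (rule hom)
  obtain m :: int where m: "\<And>h. (\<And>k. k < m \<Longrightarrow> h $$ k = 0) \<Longrightarrow> L h = 0"
    using continuous_functional_vanishes[OF hom cont] by blast
  let ?T = "{fls_subdegree f..<m}"
  let ?g = "\<Sum>i\<in>?T. fls_const (f $$ i) * fls_X_intpow i"
  have nth_sum: "(\<Sum>i\<in>T. fls_const (f $$ i) * fls_X_intpow i) $$ k = (\<Sum>i\<in>T. if i = k then f $$ i else 0)"
    if "finite T" for T k
    using that by (induction T rule: finite_induct) auto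
  have "L (f - ?g) = 0"
  proof -
    have "(f - ?g) $$ k = 0" if "k < m" for k
      using that by (simp add: nth_sum)
    then show ?thesis by (rule m)
  qed
  then have "L f = (\<Sum>i\<in>?T. f $$ i * L (fls_X_intpow i))"
    by (simp add: diff sum scale)
  also have "\<dots> = (\<Sum>i\<in>?T \<union> S. f $$ i * L (fls_X_intpow i))"
  proof (rule sum.mono_neutral_left)
    have "L (fls_X_intpow i) = 0" if "i \<ge> m" for i
      using that by (intro m) auto
    then show "\<forall>i\<in>(?T \<union> S) - ?T. f $$ i * L (fls_X_intpow i) = 0"
      by auto
  qed (use S in auto)
  also have "\<dots> = (\<Sum>i\<in>S. f $$ i * L (fls_X_intpow i))"
    using S by (intro sum.mono_neutral_right) auto
  finally show ?thesis .
qed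

text \<open>If the nonzero columns had infinitely many different last nonzero rows, a suitable
  combination \<open>F\<close> of the rows would be nonzero in infinitely many columns, against
  \<open>fin\<close>.\<close>

lemma gliding_hump:
  fixes c :: "nat \<Rightarrow> nat \<Rightarrow> 'a::comm_ring_1"
  assumes row: "\<And>i. finite {j. c i j \<noteq> 0}"
    and col: "\<And>j. finite {i. c i j \<noteq> 0}"
    and fin: "\<And>F. finite {j. (\<Sum>i\<in>{i. c i j \<noteq> 0}. F i * c i j) \<noteq> 0}"
  shows "finite {(i, j). c i j \<noteq> 0}"
proof -
  define S where "S = {j. \<exists>i. c i j \<noteq> 0}"
  define m where "m j = Max {i. c i j \<noteq> 0}" for j
  have m: "c (m j) j \<noteq> 0" "\<And>i. c i j \<noteq> 0 \<Longrightarrow> i \<le> m j" if "j \<in> S" for j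
  proof -
    show "c (m j) j \<noteq> 0"
      using Max_in[OF col[of j]] that by (auto simp: S_def m_def)
    show "i \<le> m j" if "c i j \<noteq> 0" for i
      using Max_ge[OF col[of j], of i] that by (simp add: m_def)
  qed
  \<comment> \<open>One representative column for each value of the last nonzero row.\<close>
  define J where "J i = (SOME j. j \<in> S \<and> m j = i)" for i
  have J: "J (m j) \<in> S" "m (J (m j)) = m j" if "j \<in> S" for j
    using someI[of "\<lambda>k. k \<in> S \<and> m k = m j" j] that by (auto simp: J_def)
  \<comment> \<open>In column \<open>J n\<close> the entry in row \<open>n\<close> is the last
    nonzero one, so \<open>F n\<close> is free to decide whether the sum vanishes: 1 if the earlier
    terms cancel, 0 otherwise. This works in the presence of zero divisors.\<close>
  obtain F :: "nat \<Rightarrow> 'a"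
    where F: "\<And>n. F n = (if (\<Sum>k<n. F k * c k (J n)) = 0 then 1 else 0)"
  proof -
    define G where "G = wfrec less_than (\<lambda>F n. if (\<Sum>k<n. F k * c k (J n)) = 0 then 1 else (0::'a))"
    have "G n = (if (\<Sum>k<n. G k * c k (J n)) = 0 then 1 else 0)" for n
    proof -
      have "(\<Sum>k<n. cut G less_than n k * c k (J n)) = (\<Sum>k<n. G k * c k (J n))"
        by (intro sum.cong) (auto simp: cut_def)
      then show ?thesis
        by (subst def_wfrec[OF G_def[THEN eq_reflection] wf_less_than]) (simp only:)
    qed
    then show ?thesis by (rule that)
  qed
  have "(\<Sum>i\<in>{i. c i j \<noteq> 0}. F i * c i j) \<noteq> 0" if j: "j \<in> J ` m ` S" for j
  proof -
    from j obtain n where n: "j \<in> S" "m j = n" "J n = j" using J by auto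
    have "(\<Sum>i\<in>{i. c i j \<noteq> 0}. F i * c i j) = (\<Sum>i<Suc n. F i * c i j)"
      using m[OF n(1)] n by (intro sum.mono_neutral_left) (auto simp: less_Suc_eq_le)
    also have "\<dots> = (\<Sum>i<n. F i * c i (J n)) + F n * c n (J n)"
      by (simp add: n)
    also have "\<dots> \<noteq> 0"
      using m(1)[OF n(1)] n by (subst F[of n]) auto
    finally show ?thesis .
  qed
  then have "finite (J ` m ` S)"
    using finite_subset[OF _ fin[of F]] by blast
  moreover have "inj_on J (m ` S)"
  proof (rule inj_onI)
    fix a b assume "a \<in> m ` S" "b \<in> m ` S" "J a = J b"
    then show "a = b" using J(2) by (metis imageE)
  qed
  ultimately have "finite (m ` S)" by (rule finite_imageD)
  moreover have "S \<subseteq> (\<Union>i\<in>m ` S. {j. c i j \<noteq> 0})"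
    using m by auto
  ultimately have "finite S"
    using row finite_subset by blast
  then have "finite (\<Union>j\<in>S. {i. c i j \<noteq> 0} \<times> {j})"
    using col by simp
  moreover have "{(i, j). c i j \<noteq> 0} \<subseteq> \<dots>"
    by (auto simp: S_def)
  ultimately show ?thesis by (rule finite_subset[rotated])
qed

text \<open>Substitute for division by integers in a ring with torsion.\<close>

lemma eq_zero_if_consecutive_multiples_zero:
  fixes a :: "'a::comm_ring_1"
  assumes "of_int k * a = 0" "of_int (k + 1) * a = 0"
  shows "a = 0"
  using assms by (simp add: distrib_right)

subsection \<open>Invariant pairings\<close>

locale invariant_pairing =
  fixes B :: "'a::comm_ring_1 fls \<Rightarrow> 'a fls \<Rightarrow> 'a"
  assumes bilinear: "fls_bilinear B"
    and continuous: "fls_separately_continuous B"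
    and invariant: "l \<ge> 2 \<Longrightarrow> B f g = B (fls_phi l f) (fls_phi l g)"
begin

section \<open>Matrix of the pairing on monomials and its finiteness\<close>

definition gram :: "int \<Rightarrow> int \<Rightarrow> 'a" where
  "gram i j = B (fls_X_intpow i) (fls_X_intpow j)"

lemma hom_left: "module_hom (\<lambda>a h. fls_const a * h) (*) (\<lambda>f. B f g)"
  and hom_right: "module_hom (\<lambda>a h. fls_const a * h) (*) (\<lambda>g. B f g)"
  using bilinear unfolding fls_bilinear_def by blast+

lemma cont_left: "continuous_map euclidean (discrete_topology UNIV) (\<lambda>f. B f g)"
  and cont_right: "continuous_map euclidean (discrete_topology UNIV) (\<lambda>g. B f g)"
  using continuous unfolding fls_separately_continuous_def by blast+

lemmas expand_left = continuous_functional_expand[OF hom_left cont_left]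
lemmas expand_right = continuous_functional_expand[OF hom_right cont_right]

lemma scale_left: "B (fls_const a * f) g = a * B f g"
  by (rule module_hom.scale[OF hom_left])

lemma expand:
  assumes S: "finite S" and T: "finite T"
    and z: "\<And>i j. i \<notin> S \<or> j \<notin> T \<Longrightarrow> f $$ i * g $$ j * gram i j = 0"
  shows "B f g = (\<Sum>i\<in>S. \<Sum>j\<in>T. f $$ i * g $$ j * gram i j)"
proof -
  have *: "f $$ i * B (fls_X_intpow i) g = (\<Sum>j\<in>T. f $$ i * g $$ j * gram i j)" for i
  proof -
    \<comment> \<open>With the coefficient absorbed into the first argument, \<open>T\<close> has to
      capture only the terms where \<open>f $$ i\<close> does not kill the entry, which is what
      \<open>z\<close> provides.\<close>
    let ?h = "fls_const (f $$ i) * fls_X_intpow i"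
    have h: "g $$ j * B ?h (fls_X_intpow j) = f $$ i * g $$ j * gram i j" for j
      unfolding scale_left gram_def by (simp only: mult_ac)
    have "f $$ i * B (fls_X_intpow i) g = B ?h g"
      by (rule scale_left[symmetric])
    also have "\<dots> = (\<Sum>j\<in>T. g $$ j * B ?h (fls_X_intpow j))"
      by (intro expand_right T) (unfold h, rule z, simp)
    finally show ?thesis by (simp only: h)
  qed
  have "B f g = (\<Sum>i\<in>S. f $$ i * B (fls_X_intpow i) g)"
    using z by (intro expand_left S) (simp add: *)
  then show ?thesis by (simp only: *)
qed

lemma finite_right: "finite {j. j \<ge> s \<and> B f (fls_X_intpow j) \<noteq> 0}"
proof -
  obtain m :: int where m: "\<And>h. (\<And>k. k < m \<Longrightarrow> h $$ k = 0) \<Longrightarrow> B f h = 0"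
    using continuous_functional_vanishes[OF hom_right cont_right] by blast
  have "j < m" if "B f (fls_X_intpow j) \<noteq> 0" for j
  proof (rule ccontr)
    assume "\<not> j < m"
    then have "B f (fls_X_intpow j) = 0" by (intro m) auto
    with that show False by simp
  qed
  then have "{j. j \<ge> s \<and> B f (fls_X_intpow j) \<noteq> 0} \<subseteq> {s..<m}" by auto
  then show ?thesis by (rule finite_subset) simp
qed

text \<open>Transfers facts about the second argument to the first.\<close>

lemma invariant_pairing_flip: "invariant_pairing (\<lambda>f g. B g f)"
proof
  show "fls_bilinear (\<lambda>f g. B g f)"
    using bilinear by (simp add: fls_bilinear_def)
  show "fls_separately_continuous (\<lambda>f g. B g f)"
    using continuous by (simp add: fls_separately_continuous_def)
qed (rule invariant)

lemma finite_left: "finite {i. i \<ge> s \<and> B (fls_X_intpow i) g \<noteq> 0}"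
  by (rule invariant_pairing.finite_right[OF invariant_pairing_flip])

text \<open>Any combination of the rows from \<open>s\<close> on is the pairing of monomials with a
  genuine Laurent series \<open>f\<close>, bounded below by \<open>s\<close>. Continuity in the
  second argument makes it finitely supported, so \<open>gliding_hump\<close> applies.\<close>

lemma finite_quadrant: "finite {(i, j). i \<ge> s \<and> j \<ge> s \<and> gram i j \<noteq> 0}"
proof -
  let ?gram = "\<lambda>i j. gram (s + int i) (s + int j)"
  have shift: "finite {i::nat. P (s + int i)}" if "finite {i. i \<ge> s \<and> P i}" for P
  proof -
    have "finite ((\<lambda>i. s + int i) ` {i. P (s + int i)})"
      by (rule finite_subset[OF _ that]) auto
    then show ?thesis by (rule finite_imageD) (auto intro: inj_onI)
  qed
  have row: "finite {j. ?gram i j \<noteq> 0}" for i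
    using shift[OF finite_right[of s "fls_X_intpow (s + int i)"]] by (simp add: gram_def)
  have col: "finite {i. ?gram i j \<noteq> 0}" for j
    using shift[OF finite_left[of s "fls_X_intpow (s + int j)"]] by (simp add: gram_def)
  have "finite {(i, j). ?gram i j \<noteq> 0}"
  proof (rule gliding_hump[OF row col])
    fix F :: "nat \<Rightarrow> 'a"
    define f where "f = Abs_fls (\<lambda>i. if i \<ge> s then F (nat (i - s)) else 0)"
    have f: "f $$ i = (if i \<ge> s then F (nat (i - s)) else 0)" for i
      unfolding f_def by (rule nth_Abs_fls_lower_bound[of s]) auto
    have "B f (fls_X_intpow (s + int j)) = (\<Sum>i\<in>{i. ?gram i j \<noteq> 0}. F i * ?gram i j)" for j
    proof -
      let ?S = "(\<lambda>i. s + int i) ` {i. ?gram i j \<noteq> 0}"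
      have "B f (fls_X_intpow (s + int j)) = (\<Sum>i\<in>?S. f $$ i * B (fls_X_intpow i) (fls_X_intpow (s + int j)))"
      proof (rule expand_left)
        fix i assume i: "i \<notin> ?S"
        show "f $$ i * B (fls_X_intpow i) (fls_X_intpow (s + int j)) = 0"
        proof (cases "i \<ge> s")
          case True
          then have "i = s + int (nat (i - s))" by simp
          with i have "gram i (s + int j) = 0" by (metis (mono_tags, lifting) image_eqI mem_Collect_eq)
          then show ?thesis by (simp add: gram_def)
        qed (simp add: f)
      qed (use col in auto)
      also have "\<dots> = (\<Sum>i\<in>{i. ?gram i j \<noteq> 0}. F i * ?gram i j)"
        by (subst sum.reindex) (auto intro: inj_onI simp: f gram_def)
      finally show ?thesis .
    qed
    then show "finite {j. (\<Sum>i\<in>{i. ?gram i j \<noteq> 0}. F i * ?gram i j) \<noteq> 0}"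
      using shift[OF finite_right[of s f]] by simp
  qed
  then have "finite ((\<lambda>(i, j). (s + int i, s + int j)) ` {(i, j). ?gram i j \<noteq> 0})"
    by (rule finite_imageI)
  moreover have "{(i, j). i \<ge> s \<and> j \<ge> s \<and> gram i j \<noteq> 0} \<subseteq> \<dots>"
  proof clarify
    fix i j assume "i \<ge> s" "j \<ge> s" "gram i j \<noteq> 0"
    then show "(i, j) \<in> (\<lambda>(i, j). (s + int i, s + int j)) ` {(i, j). ?gram i j \<noteq> 0}"
      by (intro image_eqI[of _ _ "(nat (i - s), nat (j - s))"]) auto
  qed
  ultimately show ?thesis by (rule finite_subset[rotated])
qed

lemma quadrant_bound: "\<exists>D. \<forall>i j. i \<ge> s \<longrightarrow> j \<ge> s \<longrightarrow> i + j > D \<longrightarrow> gram i j = 0"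
proof -
  let ?S = "{(i, j). i \<ge> s \<and> j \<ge> s \<and> gram i j \<noteq> 0}"
  have "finite ((\<lambda>(i, j). i + j) ` ?S)" using finite_quadrant by blast
  then obtain D where *: "\<forall>x\<in>(\<lambda>(i, j). i + j) ` ?S. x \<le> D"
    using bdd_above_finite unfolding bdd_above_def by blast
  have "gram i j = 0" if "i \<ge> s" "j \<ge> s" "i + j > D" for i j
  proof (rule ccontr)
    assume "gram i j \<noteq> 0"
    with that have "(i, j) \<in> ?S" by simp
    then have "i + j \<in> (\<lambda>(i, j). i + j) ` ?S" by (rule rev_image_eqI) simp
    with * have "i + j \<le> D" by (rule bspec)
    with that show False by simp
  qed
  then show ?thesis by blast
qed

lemma invariant_coeff:
  assumes "n \<ge> 1" "finite S" "finite T"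
    "\<And>i' j'. i' \<notin> S \<or> j' \<notin> T \<Longrightarrow>
       fls_subst_pow (Suc n) i $$ i' * fls_subst_pow (Suc n) j $$ j' * gram i' j' = 0"
  shows "gram i j = (\<Sum>i'\<in>S. \<Sum>j'\<in>T. fls_subst_pow (Suc n) i $$ i' * fls_subst_pow (Suc n) j $$ j' * gram i' j')"
proof -
  have n2: "Suc n \<ge> 2" using assms(1) by simp
  have "gram i j = B (fls_subst_pow (Suc n) i) (fls_subst_pow (Suc n) j)"
    unfolding gram_def by (subst invariant[OF n2]) (simp only: fls_phi_X_intpow[OF n2])
  also have "\<dots> = (\<Sum>i'\<in>S. \<Sum>j'\<in>T. fls_subst_pow (Suc n) i $$ i' * fls_subst_pow (Suc n) j $$ j' * gram i' j')"
    by (rule expand[OF assms(2-4)])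
  finally show ?thesis .
qed

section \<open>First-order relations and the bound on the degree\<close>

text \<open>An exponent other than the first two in either factor raises the degree by at least
  \<open>2 n\<close>, where \<open>z\<close> applies. The product of the leading terms cancels the
  left-hand side, and the product of the second terms vanishes by \<open>z\<close>.\<close>

lemma first_order:
  assumes n: "n \<ge> 1"
    and z: "\<And>i' j'. i' \<ge> i \<Longrightarrow> j' \<ge> j \<Longrightarrow> i' + j' \<ge> i + j + 2 * int n \<Longrightarrow> gram i' j' = 0"
  shows "of_int i * gram (i + int n) j + of_int j * gram i (j + int n) = 0"
proof -
  let ?p = "\<lambda>k m. fls_subst_pow (Suc n) k $$ m :: 'a"
  have p: "?p k k = 1" "?p k (k + int n) = of_int k" for k
    using n by (simp_all add: fls_subst_pow_nth)
  have p0: "?p k m = 0" if "m \<noteq> k" "m \<noteq> k + int n" "m < k + 2 * int n" for k m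
  proof (rule ccontr)
    assume "?p k m \<noteq> 0"
    then have "m \<ge> k" "int n dvd (m - k)"
      using n by (auto simp: fls_subst_pow_nth split: if_splits)
    then obtain q where q: "m - k = int n * q" by (auto elim: dvdE)
    have "0 \<le> int n * q" "int n * q < int n * 2"
      using q \<open>m \<ge> k\<close> that by linarith+
    then have "0 \<le> q" "q < 2" using n by (simp_all add: zero_le_mult_iff mult_less_cancel_left)
    then have "q = 0 \<or> q = 1" by linarith
    then show False using q that by auto
  qed
  have n2: "Suc n \<ge> 2" using n by simp
  have "gram i j = (\<Sum>i'\<in>{i, i + int n}. \<Sum>j'\<in>{j, j + int n}. ?p i i' * ?p j j' * gram i' j')"
  proof (rule invariant_coeff[OF n])
    fix i' j' assume *: "i' \<notin> {i, i + int n} \<or> j' \<notin> {j, j + int n}"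
    show "?p i i' * ?p j j' * gram i' j' = 0"
    proof (rule ccontr)
      assume "?p i i' * ?p j j' * gram i' j' \<noteq> 0"
      then have nz: "?p i i' \<noteq> 0" "?p j j' \<noteq> 0" "gram i' j' \<noteq> 0" by auto
      have ge: "i' \<ge> i" "j' \<ge> j"
        using nz(1,2) fls_subst_pow_nth_below[OF n2, of i' i, where 'a='a]
          fls_subst_pow_nth_below[OF n2, of j' j, where 'a='a] by linarith+
      with z nz(3) have "\<not> i' + j' \<ge> i + j + 2 * int n" by blast
      with ge have "i' < i + 2 * int n" "j' < j + 2 * int n" by linarith+
      with p0 nz(1,2) have "i' = i \<or> i' = i + int n" "j' = j \<or> j' = j + int n" by blast+
      with * show False by simp
    qed
  qed auto
  also have "\<dots> = gram i j + (of_int i * gram (i + int n) j + of_int j * gram i (j + int n))"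
    using n z[of "i + int n" "j + int n"] by (simp add: p)
  finally show ?thesis by simp
qed

text \<open>Vanishing spreads from exponent 1 to \<open>d + 1\<close>, from there to all exponents
  up to \<open>d\<close>, and from -1 to those above \<open>d\<close>. Each time the coefficient of
  the new entry is 1 or -1, so nothing is divided; \<open>s \<le> - 1\<close> keeps all indices
  inside the quadrant.\<close>

lemma quadrant_degree_descent:
  assumes s: "s \<le> - 1" and d: "d \<ge> 1"
    and y: "gram 1 (d - 1) = 0"
    and z: "\<And>i j. i \<ge> s \<Longrightarrow> j \<ge> s \<Longrightarrow> i + j > d \<Longrightarrow> gram i j = 0"
    and ij: "i \<ge> s" "j \<ge> s" "i + j = d"
  shows "gram i j = 0"
proof -
  define x where "x i = gram i (d - i)" for i
  have lin: "of_int i * x k + of_int (d - k) * x i = 0" if "s \<le> i" "i < k" "s \<le> d - k" for i k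
  proof -
    define n where "n = nat (k - i)"
    have n: "k = i + int n" "n \<ge> 1"
      using that by (auto simp: n_def)
    have "of_int i * gram (i + int n) (d - k) + of_int (d - k) * gram i (d - k + int n) = 0"
      by (rule first_order[OF n(2)]) (use that n in \<open>auto intro!: z\<close>)
    then show ?thesis by (simp add: n(1) x_def)
  qed
  have "x 1 = 0" using y by (simp add: x_def)
  with lin[of 1 "d + 1"] s d have top: "x (d + 1) = 0" by simp
  have low: "x i = 0" if "s \<le> i" "i \<le> d" for i
    using lin[of i "d + 1"] top that s by simp
  have "x i = 0"
  proof (cases "i \<le> d")
    case True
    then show ?thesis using low ij by simp
  next
    case False
    then show ?thesis using lin[of "-1" i] low[of "-1"] s d ij by simp
  qed
  moreover have "j = d - i" using ij(3) by simp
  ultimately show ?thesis by (simp add: x_def)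
qed

lemma degree_bound: obtains D where "\<And>i j. i + j > D \<Longrightarrow> gram i j = 0"
proof -
  obtain D0 where D0: "\<And>i j. i \<ge> 0 \<Longrightarrow> j \<ge> 0 \<Longrightarrow> i + j > D0 \<Longrightarrow> gram i j = 0"
    using quadrant_bound[of 0] by blast
  \<comment> \<open>For \<open>d > D\<close> the entry \<open>gram 1 (d - 1)\<close> lies in the
    nonnegative quadrant and vanishes by \<open>D0\<close>, which starts the descent on every larger
    quadrant.\<close>
  define D where "D = max 0 D0"
  have "gram i j = 0" if "i + j > D" for i j
  proof -
    define s where "s = min (-1) (min i j)"
    obtain E where E: "\<And>i j. i \<ge> s \<Longrightarrow> j \<ge> s \<Longrightarrow> i + j > E \<Longrightarrow> gram i j = 0"
      using quadrant_bound[of s] by blast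
    \<comment> \<open>The bound drops by one degree per step from \<open>E\<close> to the uniform
      \<open>D\<close>; truncation at zero covers \<open>E \<le> D\<close>.\<close>
    have "\<forall>i j. i \<ge> s \<longrightarrow> j \<ge> s \<longrightarrow> i + j > D + int (nat (E - D) - k) \<longrightarrow> gram i j = 0" for k
    proof (induction k)
      case 0
      then show ?case using E by auto
    next
      case (Suc k)
      show ?case
      proof (cases "k < nat (E - D)")
        case True
        define d where "d = D + int (nat (E - D) - k)"
        have dS: "D + int (nat (E - D) - Suc k) = d - 1" and d: "d > D"
          using True by (auto simp: d_def)
        have above: "gram i j = 0" if "i \<ge> s" "j \<ge> s" "i + j > d" for i j
          using Suc that unfolding d_def by blast
        have s: "s \<le> - 1" by (simp add: s_def)
        have d1: "d \<ge> 1" "gram 1 (d - 1) = 0" using d by (auto simp: D_def intro!: D0)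
        have "gram i j = 0" if "i \<ge> s" "j \<ge> s" "i + j > d - 1" for i j
        proof (cases "i + j = d")
          case True
          show ?thesis by (rule quadrant_degree_descent[OF s d1 above that(1,2) True])
        next
          case False
          with that have "i + j > d" by linarith
          then show ?thesis by (rule above[OF that(1,2)])
        qed
        then show ?thesis unfolding dS by blast
      next
        case False
        then show ?thesis using Suc by simp
      qed
    qed
    from this[of "nat (E - D)"] show ?thesis using that by (auto simp: s_def)
  qed
  then show ?thesis by (rule that)
qed

section \<open>Shape of the matrix in each degree\<close>

lemma linear_in_first_index: "\<exists>h. \<forall>d i. gram i (d - i) = of_int i * h d"
proof -
  obtain D where D: "\<And>i j. i + j > D \<Longrightarrow> gram i j = 0" using degree_bound by blast
  have "\<exists>y. \<forall>i. gram i (d - i) = of_int i * y" for d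
  proof -
    define x where "x i = gram i (d - i)" for i
    define R where "R = max 0 (D - d)"
    have lin: "of_int i * x k = of_int (k - d) * x i" if "k > i + R" for i k
    proof -
      define n where "n = nat (k - i)"
      have n: "k = i + int n" "n \<ge> 1"
        using that by (auto simp: n_def R_def)
      have "of_int i * gram (i + int n) (d - k) + of_int (d - k) * gram i (d - k + int n) = 0"
        by (rule first_order[OF n(2)]) (use that n in \<open>auto intro!: D simp: R_def\<close>)
      then show ?thesis by (simp add: n(1) x_def algebra_simps)
    qed
    \<comment> \<open>For \<open>k = d + 1\<close> the factor \<open>k - d\<close> in
      \<open>lin\<close> is 1.\<close>
    define y where "y = x (d + 1)"
    have low: "x i = of_int i * y" if "d + 1 > i + R" for i
      using lin[OF that] by (simp add: y_def)
    have high: "x k = of_int (k - d) * y" for k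
    proof -
      \<comment> \<open>Both \<open>i\<close> and \<open>i + 1\<close> lie far enough below
        \<open>k\<close> and \<open>d + 1\<close> for \<open>lin\<close> and \<open>low\<close>; the
        two multiples then determine \<open>x k\<close>.\<close>
      define i where "i = min k (d + 1) - R - 2"
      have "of_int l * (x k - of_int (k - d) * y) = 0" if "l = i \<or> l = i + 1" for l
      proof -
        have "k > l + R" "d + 1 > l + R" using that by (auto simp: i_def)
        then have "of_int l * x k = of_int (k - d) * (of_int l * y)"
          by (simp only: lin low)
        then show ?thesis by (simp only: right_diff_distrib mult.left_commute diff_self)
      qed
      then have "x k - of_int (k - d) * y = 0"
        using eq_zero_if_consecutive_multiples_zero by blast
      then show ?thesis by simp
    qed
    have "x i = of_int i * y" for i
    proof -
      \<comment> \<open>Dually, \<open>k + d\<close> and \<open>k + 1 + d\<close> lie far enough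
        above \<open>i\<close>.\<close>
      define k where "k = i + R + 1 - d"
      have "of_int l * (x i - of_int i * y) = 0" if "l = k \<or> l = k + 1" for l
      proof -
        have "l + d > i + R" using that by (auto simp: k_def)
        then have "of_int i * x (l + d) = of_int (l + d - d) * x i" by (rule lin)
        then have "of_int i * (of_int l * y) = of_int l * x i"
          unfolding high by (simp only: add_diff_cancel_right')
        then show ?thesis by (simp only: right_diff_distrib mult.left_commute diff_self)
      qed
      then have "x i - of_int i * y = 0"
        using eq_zero_if_consecutive_multiples_zero by blast
      then show ?thesis by simp
    qed
    then show ?thesis unfolding x_def by blast
  qed
  then show ?thesis by metis
qed

section \<open>Higher-order relations and torsion\<close>

text \<open>Invariance for the pair t, t^(d-1). The image of t has only two terms, weighted 1 and
  \<open>n + 1\<close> by the shape of \<open>gram\<close>, and the other image contributes the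
  binomials of \<open>d - 1\<close>. The degree \<open>d\<close> part cancels, and
  \<open>large\<close> cuts the sum off after \<open>a = r\<close>.\<close>

lemma substitution_relation:
  assumes h: "\<And>d i. gram i (d - i) = of_int i * h d"
    and D: "\<And>i j. i + j > D \<Longrightarrow> gram i j = 0"
    and n: "n \<ge> 1" and large: "d + int n * int (r + 2) > D"
  shows "(\<Sum>a\<le>r. of_int (ibinomial (d - 1) (Suc a) + (int n + 1) * ibinomial (d - 1) a)
            * h (d + int n * int (Suc a))) = 0"
proof -
  let ?p = "\<lambda>k m. fls_subst_pow (Suc n) k $$ m :: 'a"
  let ?b = "\<lambda>a. of_int (ibinomial (d - 1) a) :: 'a"
  let ?T = "(\<lambda>a. d - 1 + int n * int a) ` {..Suc r}"
  have n2: "Suc n \<ge> 2" using n by simp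
  have p1: "?p 1 m = (if m = 1 \<or> m = 1 + int n then 1 else 0)" for m
    using n by (auto simp: fls_subst_pow_def fls_X_power_nth simp del: power_Suc)
  have p: "?p (d - 1) (d - 1 + int n * int a) = ?b a" for a
    using n by (simp add: fls_subst_pow_nth)
  have inj: "inj_on (\<lambda>a. d - 1 + int n * int a) A" for A
    using n by (auto intro!: inj_onI)
  have idx: "1 + (d - 1 + int n * int a) = d + int n * int a"
    "1 + int n + (d - 1 + int n * int a) = d + int n * int (Suc a)" for a
    by (simp_all add: algebra_simps)
  have pT: "\<exists>a. m = d - 1 + int n * int a" if "?p (d - 1) m \<noteq> 0" for m
  proof -
    have m: "m \<ge> d - 1" "int n dvd (m - (d - 1))"
      using that n by (auto simp: fls_subst_pow_nth split: if_splits)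
    then obtain q where q: "m - (d - 1) = int n * q" by (auto elim: dvdE)
    with m n have "0 \<le> int n * q" by linarith
    with n have "q \<ge> 0" by (simp add: zero_le_mult_iff)
    then obtain a where "q = int a" by (auto elim: nonneg_int_cases)
    with q show ?thesis by (intro exI[of _ a]) simp
  qed
  have hc: "gram i j = of_int i * h (i + j)" for i j
    using h[of i "i + j"] by simp
  have hD: "h m = 0" if "m > D" for m
    using h[of 1 m] D[of 1 "m - 1"] that by simp
  have "gram 1 (d - 1) = (\<Sum>i\<in>{1, 1 + int n}. \<Sum>j\<in>?T. ?p 1 i * ?p (d - 1) j * gram i j)"
  proof (rule invariant_coeff[OF n])
    fix i j assume *: "i \<notin> {1, 1 + int n} \<or> j \<notin> ?T"
    show "?p 1 i * ?p (d - 1) j * gram i j = 0"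
    proof (rule ccontr)
      assume "?p 1 i * ?p (d - 1) j * gram i j \<noteq> 0"
      then have nz: "?p 1 i \<noteq> 0" "?p (d - 1) j \<noteq> 0" "gram i j \<noteq> 0" by auto
      from nz(1) have i: "i = 1 \<or> i = 1 + int n" by (simp add: p1 split: if_splits)
      from pT[OF nz(2)] obtain a where a: "j = d - 1 + int n * int a" ..
      have "a \<le> Suc r"
      proof (rule ccontr)
        assume "\<not> a \<le> Suc r"
        then have "int n * int (r + 2) \<le> int n * int a" by (intro mult_left_mono) auto
        with large i a have "i + j > D" by auto
        with D nz(3) show False by blast
      qed
      with i a * show False by auto
    qed
  qed auto
  also have "\<dots> = (\<Sum>j\<in>?T. ?p (d - 1) j * h (1 + j)) + (\<Sum>j\<in>?T. ?p (d - 1) j * (of_int (1 + int n) * h (1 + int n + j)))"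
    using n by (simp add: p1 hc)
  also have "(\<Sum>j\<in>?T. ?p (d - 1) j * h (1 + j)) = (\<Sum>a\<le>Suc r. ?b a * h (d + int n * int a))"
    by (rule sum.reindex_cong[OF inj refl]) (simp only: p idx)
  also have "\<dots> = h d + (\<Sum>a\<le>r. ?b (Suc a) * h (d + int n * int (Suc a)))"
    by (subst sum.atMost_Suc_shift) simp
  also have "(\<Sum>j\<in>?T. ?p (d - 1) j * (of_int (1 + int n) * h (1 + int n + j)))
      = (\<Sum>a\<le>Suc r. ?b a * (of_int (1 + int n) * h (d + int n * int (Suc a))))"
    by (rule sum.reindex_cong[OF inj refl]) (simp only: p idx)
  also have "\<dots> = (\<Sum>a\<le>r. ?b a * (of_int (1 + int n) * h (d + int n * int (Suc a))))"
    using large by (simp add: hD algebra_simps)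
  finally have "(\<Sum>a\<le>r. ?b (Suc a) * h (d + int n * int (Suc a)))
      + (\<Sum>a\<le>r. ?b a * (of_int (1 + int n) * h (d + int n * int (Suc a)))) = 0"
    using hc[of 1 "d - 1"] by simp
  then show ?thesis
    by (simp add: sum.distrib[symmetric] algebra_simps)
qed

lemma ibinomial_annihilates:
  assumes h: "\<And>d i. gram i (d - i) = of_int i * h d"
  shows "of_int (ibinomial m (Suc r)) * h m = 0"
proof -
  obtain D where D: "\<And>i j. i + j > D \<Longrightarrow> gram i j = 0" using degree_bound by blast
  show ?thesis
  proof (induction r arbitrary: m rule: less_induct)
    case (less r)
    have IH: "of_int (ibinomial m k) * h m = 0" if "k \<in> {1..r}" for m k
      using less.IH[of "k - 1" m] that by (cases k) auto
    \<comment> \<open>Chosen so that the cut-off degree \<open>d + n (r + 2) = m + n\<close> exceeds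
      \<open>D\<close>.\<close>
    define n where "n = nat (max 1 (D - m + 1))"
    have n: "n \<ge> 1" "m + int n > D" by (auto simp: n_def)
    \<comment> \<open>Places the last summand \<open>a = r\<close> of the relation exactly in degree
      \<open>m\<close>.\<close>
    define d where "d = m - int n * int (Suc r)"
    let ?coeff = "\<lambda>a. of_int (ibinomial (d - 1) (Suc a) + (int n + 1) * ibinomial (d - 1) a) :: 'a"
    \<comment> \<open>Modulo binomials annihilated by the induction hypothesis in degree
      \<open>m'\<close>, the coefficient is a single binomial. For \<open>a < r\<close> that one is
      annihilated as well, so only \<open>a = r\<close> survives.\<close>
    have reduce: "?coeff a * h (d + int n * int (Suc a))
        = of_int (ibinomial (d + int n * int (Suc a)) (Suc a)) * h (d + int n * int (Suc a))"
      if "a \<le> r" for a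
    proof -
      define m' where "m' = d + int n * int (Suc a)"
      define b where "b = - int n * int (Suc a) - 1"
      let ?z = "\<lambda>k. ibinomial b (Suc a - k) + (int n + 1) * ibinomial b (a - k)"
      have db: "d - 1 = m' + b" by (simp add: m'_def b_def)
      have "?coeff a = (\<Sum>k=1..a. of_int (ibinomial m' k) * of_int (?z k)) + of_int (ibinomial m' (Suc a))"
        unfolding db ibinomial_substitution_coeff[OF b_def] by (simp only: of_int_add of_int_sum of_int_mult)
      then have "?coeff a * h m' = (\<Sum>k=1..a. of_int (ibinomial m' k) * of_int (?z k)) * h m'
          + of_int (ibinomial m' (Suc a)) * h m'"
        by (subst distrib_right[symmetric]) (rule arg_cong)
      also have "(\<Sum>k=1..a. of_int (ibinomial m' k) * of_int (?z k)) * h m' = 0"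
        unfolding sum_distrib_right
      proof (rule sum.neutral, rule ballI)
        fix k assume "k \<in> {1..a}"
        then have "of_int (ibinomial m' k) * h m' = 0" using IH that by simp
        then have "of_int (?z k) * (of_int (ibinomial m' k) * h m') = 0" by (simp only: mult_zero_right)
        then show "of_int (ibinomial m' k) * of_int (?z k) * h m' = 0" by (simp only: mult_ac)
      qed
      finally show ?thesis by (simp only: m'_def add_0)
    qed
    have "0 = (\<Sum>a\<le>r. ?coeff a * h (d + int n * int (Suc a)))"
    proof (rule substitution_relation[OF h D n(1), symmetric])
      show "D < d + int n * int (r + 2)" using n(2) by (simp add: d_def algebra_simps)
    qed
    also have "\<dots> = (\<Sum>a\<le>r. of_int (ibinomial (d + int n * int (Suc a)) (Suc a)) * h (d + int n * int (Suc a)))"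
      by (intro sum.cong refl reduce) simp
    also have "\<dots> = (\<Sum>a<r. of_int (ibinomial (d + int n * int (Suc a)) (Suc a)) * h (d + int n * int (Suc a)))
        + of_int (ibinomial m (Suc r)) * h m"
      by (simp only: lessThan_Suc_atMost[symmetric] sum.lessThan_Suc) (simp add: d_def)
    also have "(\<Sum>a<r. of_int (ibinomial (d + int n * int (Suc a)) (Suc a)) * h (d + int n * int (Suc a))) = 0"
      by (rule sum.neutral) (use IH in auto)
    finally show ?case by simp
  qed
qed

lemma zero_if_degree_nonzero:
  assumes h: "\<And>d i. gram i (d - i) = of_int i * h d" and m: "m \<noteq> 0"
  shows "h m = 0"
proof -
  have ann: "of_int (ibinomial m k) * h m = 0" if "k > 0" for k
    using ibinomial_annihilates[OF h, of m "k - 1"] that by simp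
  show ?thesis
  proof (cases "m > 0")
    case True
    then show ?thesis using ann[of "nat m"] ibinomial_self[of "nat m"] by simp
  next
    case False
    define k where "k = nat (- m)"
    have k: "- m = int k" "k > 0" using False m by (auto simp: k_def)
    \<comment> \<open>In the Vandermonde expansion all summands with \<open>j > 0\<close> annihilate
      \<open>h m\<close>, and \<open>j = 0\<close> has coefficient
      \<open>ibinomial k k = 1\<close>.\<close>
    have "0 = ibinomial (m + - m) k" using k(2) by (simp add: ibinomial_0_left)
    also have "\<dots> = (\<Sum>j\<le>k. ibinomial m j * ibinomial (- m) (k - j))"
      by (rule ibinomial_Vandermonde)
    finally have "0 = of_int (\<Sum>j\<le>k. ibinomial m j * ibinomial (- m) (k - j)) * h m" by simp
    also have "\<dots> = (\<Sum>j\<le>k. of_int (ibinomial (- m) (k - j)) * (of_int (ibinomial m j) * h m))"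
      unfolding of_int_sum sum_distrib_right by (simp only: of_int_mult mult_ac)
    also have "\<dots> = of_int (ibinomial (- m) (k - 0)) * (of_int (ibinomial m 0) * h m)"
      by (rule sum.remove[of "{..k}" 0, THEN trans]) (auto simp: ann)
    finally show ?thesis by (simp add: k(1))
  qed
qed

section \<open>Identification with the residue pairing\<close>

lemma multiple_of_residue: "\<exists>e. \<forall>f g. B f g = e * fls_Res f g"
proof -
  obtain h where h: "\<And>d i. gram i (d - i) = of_int i * h d"
    using linear_in_first_index by blast
  have c0: "gram i j = (if j = - i then of_int i * h 0 else 0)" for i j
    using h[of i "i + j"] zero_if_degree_nonzero[OF h, of "i + j"] by (auto simp: add_eq_0_iff)
  \<comment> \<open>The sign arises because the derivative of t^(-i) has coefficient
    \<open>- i\<close>, whereas \<open>gram i (- i) = i h 0\<close>.\<close>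
  have "B f g = - h 0 * fls_Res f g" for f g
  proof -
    let ?s = "fls_subdegree f" and ?t = "fls_subdegree g"
    have "B f g = (\<Sum>i\<in>{?s..- ?t}. \<Sum>j\<in>{?t..- ?s}. f $$ i * g $$ j * gram i j)"
    proof (rule expand)
      fix i j assume "i \<notin> {?s..- ?t} \<or> j \<notin> {?t..- ?s}"
      then have "i < ?s \<or> j < ?t \<or> j \<noteq> - i" by auto
      then show "f $$ i * g $$ j * gram i j = 0" by (auto simp: c0)
    qed auto
    also have "\<dots> = (\<Sum>i\<in>{?s..- ?t}. f $$ i * g $$ (- i) * (of_int i * h 0))"
      by (intro sum.cong refl) (simp add: c0 if_distrib cong: if_cong)
    also have "\<dots> = - h 0 * (\<Sum>i\<in>{?s..- ?t}. f $$ i * fls_deriv g $$ (- 1 - i))"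
      by (simp add: sum_distrib_left sum_negf[symmetric] algebra_simps)
    also have "(\<Sum>i\<in>{?s..- ?t}. f $$ i * fls_deriv g $$ (- 1 - i)) = fls_Res f g"
      unfolding fls_Res_def fls_residue_def fls_times_nth(2)
    \<comment> \<open>The ranges can differ, as the derivative may lose the leading term of
      \<open>g\<close> to torsion or vanish; the surplus terms on either side are zero.\<close>
    proof (rule sum.mono_neutral_cong)
      fix i assume "i \<in> {?s..- ?t} - {?s..- 1 - fls_subdegree (fls_deriv g)}"
      then have "fls_deriv g $$ (- 1 - i) = 0" by (intro fls_eq0_below_subdegree) auto
      then show "f $$ i * fls_deriv g $$ (- 1 - i) = 0" by (simp only: mult_zero_right)
    qed auto
    finally show ?thesis .
  qed
  then show ?thesis by blast
qed

end

theorem theorem1: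
  fixes B :: "'a::comm_ring_1 fls \<Rightarrow> 'a fls \<Rightarrow> 'a"
  assumes "fls_bilinear B"
    and "fls_separately_continuous B"
    and "\<And>f g l. l \<ge> 2 \<Longrightarrow> B f g = B (fls_phi l f) (fls_phi l g)"
  shows "\<exists>e. \<forall>f g. B f g = e * fls_Res f g"
proof -
  interpret invariant_pairing B by unfold_locales (fact assms)+
  show ?thesis by (rule multiple_of_residue)
qed

end
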